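(* Let $a\ge 2$ be an integer. Let $$T_1=\sum_{i_1=1}^{2}\sum_{i_2=1}^{2}\sum_{i_3=1}^{a+2} v^1_{i_1}\otimes v^2_{i_2}\otimes v^3_{i_3}\otimes v^4_{i_1,i_2,i_3}\in V_1\otimes V_2\otimes V_3\otimes V_4,$$ where $V_1=V_2=\mathbb{C}^2$ have bases $\{v^p_1,v^p_2\}$ ($p=1,2$), $V_3=\mathbb{C}^{a+2}$ has basis $\{v^3_i:1\le i\le a+2\}$, and $V_4=\mathbb{C}^{4(a+2)}$ has basis $\{v^4_{i_1,i_2,i_3}: i_1,i_2\in\{1,2\},\ 1\le i_3\le a+2\}$. Let $$T_2=\sum_{j=1}^{a} w^1_j\otimes w^2_j\otimes w^3\otimes w^4\in W_1\otimes W_2\otimes W_3\otimes W_4,$$ where $W_p=\mathbb{C}^a$ has basis $\{w^p_j:1\le j\le a\}$ for $p=1,2$, and $W_p=\mathbb{C}^1$ is spanned by $w^p$ for $p=3,4$. Then $$\underline{\mathrm{R}}(T_1)=4(a+2),\qquad \underline{\mathrm{R}}(T_2)=a,$$ and $$\underline{\mathrm{R}}(T_1\oplus T_2)=4(a+2)+1.$$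
   Context: All vector spaces are finite dimensional over $\mathbb{C}$. For a tensor $T\in V_1\otimes\cdots\otimes V_k$, the tensor rank $\mathrm{R}(T)$ is the least $r$ such that $T=\sum_{i=1}^r v_1^{(i)}\otimes\cdots\otimes v_k^{(i)}$ with $v_j^{(i)}\in V_j$. The border rank $\underline{\mathrm{R}}(T)$ is the least $r$ such that $T=\lim_{\varepsilon\to0}T_\varepsilon$ (Euclidean topology) for tensors $T_\varepsilon\in V_1\otimes\cdots\otimes V_k$ with $\mathrm{R}(T_\varepsilon)=r$ for $\varepsilon\ne0$. For $T\in V_1\otimes\cdots\otimes V_k$ and $S\in W_1\otimes\cdots\otimes W_k$, the direct sum $T\oplus S$ is the tensor $T+S\in (V_1\oplus W_1)\otimes\cdots\otimes(V_k\oplus W_k)$, where $V_j,W_j$ are regarded as the two summands of $V_j\oplus W_j$. *)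

theory Defs
  imports "HOL-Analysis.Analysis"
begin

text \<open>
  A finite-dimensional complex vector space with a chosen basis is given by the finite
  set \<open>I\<close> of indices of that basis; its vectors are the coordinate functions
  vanishing outside \<open>I\<close>. An element of \<open>V\<^sub>1 \<otimes> \<dots> \<otimes> V\<^sub>k\<close> is given by its coordinates in
  the product basis, which is indexed by \<open>listset [I\<^sub>1, \<dots>, I\<^sub>k]\<close>, that is, by the lists
  \<open>[x\<^sub>1, \<dots>, x\<^sub>k]\<close> with \<open>x\<^sub>j \<in> I\<^sub>j\<close>.
\<close>

definition vec_space :: "'i set \<Rightarrow> ('i \<Rightarrow> complex) set" where
  "vec_space I = {v. \<forall>x. x \<notin> I \<longrightarrow> v x = 0}"

definition basis_vec :: "'i \<Rightarrow> 'i \<Rightarrow> complex" where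
  "basis_vec i = (\<lambda>x. if x = i then 1 else 0)"

definition tensor_space :: "'i set list \<Rightarrow> ('i list \<Rightarrow> complex) set" where
  "tensor_space Is = {T. \<forall>xs. xs \<notin> listset Is \<longrightarrow> T xs = 0}"

text \<open>\<open>simple_tensor [v\<^sub>1, \<dots>, v\<^sub>k]\<close> is \<open>v\<^sub>1 \<otimes> \<dots> \<otimes> v\<^sub>k\<close>.\<close>

definition simple_tensor :: "('i \<Rightarrow> complex) list \<Rightarrow> 'i list \<Rightarrow> complex" where
  "simple_tensor vs =
     (\<lambda>xs. if length xs = length vs then \<Prod>j<length vs. (vs ! j) (xs ! j) else 0)"

definition tensor_rank :: "'i set list \<Rightarrow> ('i list \<Rightarrow> complex) \<Rightarrow> nat" where
  "tensor_rank Is T =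
     (LEAST r. \<exists>v. (\<forall>i<r. v i \<in> listset (map vec_space Is)) \<and>
                   T = (\<lambda>xs. \<Sum>i<r. simple_tensor (v i) xs))"

definition tensor_dist ::
  "'i set list \<Rightarrow> ('i list \<Rightarrow> complex) \<Rightarrow> ('i list \<Rightarrow> complex) \<Rightarrow> real" where
  "tensor_dist Is S T = L2_set (\<lambda>xs. dist (S xs) (T xs)) (listset Is)"

definition border_rank :: "'i set list \<Rightarrow> ('i list \<Rightarrow> complex) \<Rightarrow> nat" where
  "border_rank Is T =
     (LEAST r. \<exists>F :: complex \<Rightarrow> 'i list \<Rightarrow> complex.
        (\<forall>\<epsilon>. \<epsilon> \<noteq> 0 \<longrightarrow> F \<epsilon> \<in> tensor_space Is \<and> tensor_rank Is (F \<epsilon>) = r) \<and>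
        ((\<lambda>\<epsilon>. tensor_dist Is (F \<epsilon>) T) \<longlongrightarrow> 0) (at 0))"

text \<open>
  The basis of \<open>V\<^sub>j \<oplus> W\<^sub>j\<close> is the disjoint union of the two bases. In \<open>direct_sum T S\<close>
  the first summand is the image of \<open>T\<close> and the second the image of \<open>S\<close> under the
  inclusions into \<open>(V\<^sub>1 \<oplus> W\<^sub>1) \<otimes> \<dots> \<otimes> (V\<^sub>k \<oplus> W\<^sub>k)\<close>.
\<close>

definition sum_spaces :: "'i set list \<Rightarrow> 'j set list \<Rightarrow> ('i + 'j) set list" where
  "sum_spaces Is Js = map2 (<+>) Is Js"

definition direct_sum ::
  "('i list \<Rightarrow> complex) \<Rightarrow> ('j list \<Rightarrow> complex) \<Rightarrow> ('i + 'j) list \<Rightarrow> complex" where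
  "direct_sum T S =
     (\<lambda>zs. (if set zs \<subseteq> range Inl then T (map projl zs) else 0) +
           (if set zs \<subseteq> range Inr then S (map projr zs) else 0))"

text \<open>
  All factors of a tensor share one index type. For \<open>T1\<close> it is \<open>nat list\<close>: the basis
  vector \<open>v\<^sup>p\<^sub>i\<close> with \<open>p \<le> 3\<close> has index \<open>[i]\<close>, and the basis vector of \<open>V\<^sub>4\<close> with
  subscripts \<open>i1, i2, i3\<close> has index \<open>[i1, i2, i3]\<close>. For \<open>T2\<close> it is \<open>nat\<close>, the vectors
  \<open>w\<^sup>3\<close> and \<open>w\<^sup>4\<close> having index 1.
\<close>

definition V_spaces :: "nat \<Rightarrow> nat list set list" where
  "V_spaces a =
     [{[i] | i. i \<in> {1..2}}, {[i] | i. i \<in> {1..2}}, {[i] | i. i \<in> {1..a+2}},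
      {[i1, i2, i3] | i1 i2 i3. i1 \<in> {1..2} \<and> i2 \<in> {1..2} \<and> i3 \<in> {1..a+2}}]"

definition T1 :: "nat \<Rightarrow> nat list list \<Rightarrow> complex" where
  "T1 a = (\<lambda>xs. \<Sum>i1=1..2. \<Sum>i2=1..2. \<Sum>i3=1..a+2.
     simple_tensor [basis_vec [i1], basis_vec [i2], basis_vec [i3], basis_vec [i1, i2, i3]] xs)"

definition W_spaces :: "nat \<Rightarrow> nat set list" where
  "W_spaces a = [{1..a}, {1..a}, {1}, {1}]"

definition T2 :: "nat \<Rightarrow> nat list \<Rightarrow> complex" where
  "T2 a = (\<lambda>xs. \<Sum>j=1..a.
     simple_tensor [basis_vec j, basis_vec j, basis_vec 1, basis_vec 1] xs)"

end

theory Submission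
  imports Defs
begin

text \<open>
  All three lower bounds come from flattenings. Regard a tensor as a linear map from the
  dual of the tensor product of all factors but one to the remaining factor. A sum of \<open>r\<close> simple
  tensors gives a map of rank at most \<open>r\<close>, and having rank at least \<open>n\<close> is an open condition.
  Flattening \<open>T1\<close> and \<open>T1 \<oplus> T2\<close> to the fourth factor and \<open>T2\<close> to the first one gives
  surjective maps, so the border ranks are at least the dimensions \<open>4 (a + 2)\<close>,
  \<open>4 (a + 2) + 1\<close> and \<open>a\<close> of these factors. For \<open>T1\<close> and \<open>T2\<close> the defining sums have just
  as many terms. Lemma \<open>border_rank_eqI\<close> combines a flattening with a family of approximations.

  The upper bound for \<open>T1 \<oplus> T2\<close> is a construction in the style of Schoenhage. Let
  \<open>s\<^sub>1 = 1\<close>, \<open>s\<^sub>2 = -1\<close>, let \<open>\<alpha>\<^sub>k\<close> and \<open>\<beta>\<^sub>k\<close> be vectors of the first two spaces \<open>W\<close>, and \<open>\<gamma>\<^sub>k\<close>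
  scalars (\<open>1 \<le> k \<le> a + 2\<close>). Consider
  \<open>P = \<Sum>\<^sub>i\<^sub>j\<^sub>k (v\<^sub>i + \<epsilon> s\<^sub>i \<alpha>\<^sub>k) \<otimes> (v\<^sub>j + \<epsilon> s\<^sub>j \<beta>\<^sub>k) \<otimes> (v\<^sub>k + \<epsilon> s\<^sub>i s\<^sub>j \<gamma>\<^sub>k w / 4)\<close>.
  The terms of degree 1 and 2 in \<open>\<epsilon>\<close> vanish when \<open>\<Sum> \<gamma>\<^sub>k = 0\<close>, \<open>\<Sum> \<gamma>\<^sub>k \<alpha>\<^sub>k = 0\<close> and
  \<open>\<Sum> \<gamma>\<^sub>k \<beta>\<^sub>k = 0\<close>; the constant term is the single simple tensor
  \<open>Q = (\<Sum> v\<^sub>i) \<otimes> (\<Sum> v\<^sub>j) \<otimes> (\<Sum> v\<^sub>k)\<close>, and the term of degree 3 is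
  \<open>\<epsilon>\<^sup>3 (\<Sum> \<gamma>\<^sub>k \<alpha>\<^sub>k \<otimes> \<beta>\<^sub>k) \<otimes> w\<close> (\<open>perturbed_product_expansion\<close>). If moreover
  \<open>\<Sum> \<gamma>\<^sub>k \<alpha>\<^sub>k \<otimes> \<beta>\<^sub>k = \<Sum> w\<^sub>l \<otimes> w\<^sub>l\<close>, then appending the factor \<open>v\<^sub>i\<^sub>j\<^sub>k + \<epsilon>\<^sup>-\<^sup>3 w\<close> to the
  summands of \<open>P\<close> and subtracting \<open>\<epsilon>\<^sup>-\<^sup>3 Q \<otimes> w\<close> produces \<open>T2\<close> exactly, plus a sum that tends to
  \<open>T1\<close>. This uses \<open>4 (a + 2) + 1\<close> simple tensors.

  Such data exist because for the symmetric form \<open>\<Sum> \<gamma>\<^sub>k x\<^sub>k y\<^sub>k\<close> on the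
  \<open>(a + 2)\<close>-dimensional space, with nonzero \<open>\<gamma>\<^sub>k\<close> of sum 0, the all-ones vector is isotropic
  and the quotient of its orthogonal complement by its span is a nondegenerate space of dimension \<open>a\<close>.
  The coordinates of \<open>\<alpha>\<close> and \<open>\<beta>\<close> are dual bases of this quotient.
\<close>

section \<open>Coordinates of tensors\<close>

lemma mem_listset_iff: "xs \<in> listset Is \<longleftrightarrow> list_all2 (\<in>) xs Is"
  by (induction Is arbitrary: xs) (auto simp: set_Cons_def list_all2_Cons2)

lemma finite_listset:
  assumes "\<forall>I \<in> set Is. finite I"
  shows "finite (listset Is)"
  using assms
proof (induction Is)
  case (Cons I Is)
  have "set_Cons I (listset Is) = (\<lambda>(x, xs). x # xs) ` (I \<times> listset Is)"
    by (auto simp: set_Cons_def)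
  with Cons show ?case by simp
qed simp

lemma simple_tensor_zero_outside:
  assumes "vs \<in> listset (map vec_space Is)" "xs \<notin> listset Is"
  shows "simple_tensor vs xs = 0"
proof (cases "length xs = length vs")
  case True
  have len: "length vs = length Is" and mem: "\<And>j. j < length Is \<Longrightarrow> vs ! j \<in> vec_space (Is ! j)"
    using assms(1) by (auto simp: mem_listset_iff list_all2_conv_all_nth)
  obtain j where "j < length Is" "xs ! j \<notin> Is ! j"
    using assms(2) True len by (auto simp: mem_listset_iff list_all2_conv_all_nth)
  then have "\<exists>j \<in> {..<length vs}. (vs ! j) (xs ! j) = 0"
    using mem[of j] len by (auto simp: vec_space_def)
  then show ?thesis by (auto simp: simple_tensor_def)
qed (simp add: simple_tensor_def)

lemma simple_tensor_update:
  assumes "p < length vs" "length xs = length vs"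
  shows "simple_tensor vs (xs[p := y]) = (\<Prod>j \<in> {..<length vs} - {p}. (vs ! j) (xs ! j)) * (vs ! p) y"
proof -
  have "simple_tensor vs (xs[p := y]) = (\<Prod>j<length vs. (vs ! j) (xs[p := y] ! j))"
    using assms by (simp add: simple_tensor_def)
  also have "\<dots> = (vs ! p) (xs[p := y] ! p) * (\<Prod>j \<in> {..<length vs} - {p}. (vs ! j) (xs[p := y] ! j))"
    using assms by (subst prod.remove[of _ p]) auto
  also have "(\<Prod>j \<in> {..<length vs} - {p}. (vs ! j) (xs[p := y] ! j)) =
      (\<Prod>j \<in> {..<length vs} - {p}. (vs ! j) (xs ! j))"
    by (rule prod.cong) auto
  finally show ?thesis using assms by (simp add: mult.commute)
qed

lemma simple_tensor_4:
  "simple_tensor [u1, u2, u3, u4] [x1, x2, x3, x4] = u1 x1 * u2 x2 * u3 x3 * u4 x4"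
  by (simp add: simple_tensor_def lessThan_Suc numeral_eq_Suc mult_ac)

section \<open>Tensor rank\<close>

lemma tensor_rank_le_card:
  assumes "finite K" "\<And>t. t \<in> K \<Longrightarrow> v t \<in> listset (map vec_space Is)"
  shows "tensor_rank Is (\<lambda>xs. \<Sum>t\<in>K. simple_tensor (v t) xs) \<le> card K"
proof -
  obtain h where h: "bij_betw h {..<card K} K"
    using ex_bij_betw_nat_finite[OF assms(1)] by (auto simp: atLeast0LessThan)
  have "(\<lambda>xs. \<Sum>t\<in>K. simple_tensor (v t) xs) = (\<lambda>xs. \<Sum>i<card K. simple_tensor (v (h i)) xs)"
    by (intro ext sum.reindex_bij_betw[OF h, symmetric])
  moreover have "\<forall>i<card K. v (h i) \<in> listset (map vec_space Is)"
    using h assms(2) by (auto simp: bij_betw_def)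
  ultimately show ?thesis
    unfolding tensor_rank_def by (intro Least_le exI[of _ "\<lambda>i. v (h i)"]) auto
qed

text \<open>
  In the coordinate expansion of a tensor each coordinate is absorbed into the first factor,
  so there has to be at least one factor.
\<close>

lemma tensor_rank_attained:
  assumes "Is \<noteq> []" "\<forall>I \<in> set Is. finite I" "T \<in> tensor_space Is"
  obtains v where "\<And>i. i < tensor_rank Is T \<Longrightarrow> v i \<in> listset (map vec_space Is)"
    "T = (\<lambda>xs. \<Sum>i<tensor_rank Is T. simple_tensor (v i) xs)"
proof -
  define v where "v xs = (map basis_vec xs)[0 := (\<lambda>x. T xs * basis_vec (xs ! 0) x)]" for xs
  let ?L = "listset Is"
  have fin: "finite ?L" using assms(2) by (rule finite_listset)
  have v_mem: "v xs \<in> listset (map vec_space Is)" if "xs \<in> ?L" for xs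
    using that assms(1)
    by (auto simp: v_def mem_listset_iff list_all2_conv_all_nth vec_space_def basis_vec_def nth_list_update)
  have v_val: "simple_tensor (v xs) ys = (if xs = ys then T ys else 0)"
    if "xs \<in> ?L" "ys \<in> ?L" for xs ys
  proof -
    have len: "length xs = length ys" "0 < length xs"
      using that assms(1) by (auto simp: mem_listset_iff list_all2_conv_all_nth)
    have "simple_tensor (v xs) ys = (\<Prod>j<length xs. (v xs ! j) (ys ! j))"
      using len by (simp add: simple_tensor_def v_def)
    also have "\<dots> = (v xs ! 0) (ys ! 0) * (\<Prod>j\<in>{..<length xs} - {0}. (v xs ! j) (ys ! j))"
      using len by (subst prod.remove[of _ 0]) auto
    also have "\<dots> = T xs * (basis_vec (xs ! 0) (ys ! 0) *
        (\<Prod>j\<in>{..<length xs} - {0}. basis_vec (xs ! j) (ys ! j)))"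
      using len by (simp add: v_def)
    also have "\<dots> = T xs * (\<Prod>j<length xs. basis_vec (xs ! j) (ys ! j))"
      using len by (subst (2) prod.remove[of _ 0]) auto
    also have "(\<Prod>j<length xs. basis_vec (xs ! j) (ys ! j) :: complex) = (if xs = ys then 1 else 0)"
    proof (cases "xs = ys")
      case False
      then obtain j where "j < length xs" "xs ! j \<noteq> ys ! j"
        using len nth_equalityI by blast
      then have "\<exists>j\<in>{..<length xs}. (basis_vec (xs ! j) (ys ! j) :: complex) = 0"
        by (intro bexI[of _ j]) (auto simp: basis_vec_def)
      then show ?thesis using False by simp
    qed (simp add: basis_vec_def)
    finally show ?thesis by simp
  qed
  have T_eq: "T = (\<lambda>ys. \<Sum>xs\<in>?L. simple_tensor (v xs) ys)"
  proof
    fix ys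
    show "T ys = (\<Sum>xs\<in>?L. simple_tensor (v xs) ys)"
    proof (cases "ys \<in> ?L")
      case True
      then have "(\<Sum>xs\<in>?L. simple_tensor (v xs) ys) = (\<Sum>xs\<in>?L. if xs = ys then T ys else 0)"
        by (intro sum.cong) (simp_all add: v_val)
      then show ?thesis using True fin by simp
    next
      case False
      then show ?thesis
        using assms(3) simple_tensor_zero_outside[OF v_mem False] by (simp add: tensor_space_def)
    qed
  qed
  obtain h where h: "bij_betw h {..<card ?L} ?L"
    using ex_bij_betw_nat_finite[OF fin] by (auto simp: atLeast0LessThan)
  have "\<forall>i<card ?L. (v \<circ> h) i \<in> listset (map vec_space Is)"
    using h v_mem by (auto simp: bij_betw_def)
  moreover have "T = (\<lambda>xs. \<Sum>i<card ?L. simple_tensor ((v \<circ> h) i) xs)"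
    by (subst T_eq, intro ext) (simp add: sum.reindex_bij_betw[OF h, symmetric])
  ultimately have "\<exists>(r::nat) w. (\<forall>i<r. w i \<in> listset (map vec_space Is)) \<and>
      T = (\<lambda>xs. \<Sum>i<r. simple_tensor (w i) xs)"
    by blast
  from LeastI_ex[OF this] that show thesis
    unfolding tensor_rank_def by blast
qed

text \<open>
  Gaussian elimination, one equation and one unknown at a time.
\<close>

lemma underdetermined_system_solvable:
  fixes b :: "nat \<Rightarrow> 'y \<Rightarrow> 'a::field"
  assumes "finite Y" "r < card Y"
  shows "\<exists>x. (\<exists>y\<in>Y. x y \<noteq> 0) \<and> (\<forall>i<r. (\<Sum>y\<in>Y. b i y * x y) = 0)"
  using assms
proof (induction r arbitrary: Y b)
  case 0
  then have "Y \<noteq> {}" by auto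
  then show ?case by (intro exI[of _ "\<lambda>_. 1"]) auto
next
  case (Suc r)
  show ?case
  proof (cases "\<forall>y\<in>Y. b r y = 0")
    case True
    from Suc.IH[of Y b] Suc.prems obtain x
      where "\<exists>y\<in>Y. x y \<noteq> 0" "\<forall>i<r. (\<Sum>y\<in>Y. b i y * x y) = 0" by auto
    with True show ?thesis by (intro exI[of _ x]) (auto simp: less_Suc_eq)
  next
    case False
    then obtain z where z: "z \<in> Y" "b r z \<noteq> 0" by blast
    let ?Z = "Y - {z}"
    \<comment> \<open>Equation \<open>r\<close> is solved for the unknown \<open>z\<close> and substituted into the others.\<close>
    define c where "c i y = b i y - b i z * b r y / b r z" for i y
    have "r < card ?Z" "finite ?Z" using Suc.prems z by auto
    from Suc.IH[OF this(2,1), of c] obtain x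
      where x: "\<exists>y\<in>?Z. x y \<noteq> 0" "\<And>i. i < r \<Longrightarrow> (\<Sum>y\<in>?Z. c i y * x y) = 0" by auto
    define t where "t = - (\<Sum>y\<in>?Z. b r y * x y) / b r z"
    have split: "(\<Sum>y\<in>Y. b i y * (x(z := t)) y) = b i z * t + (\<Sum>y\<in>?Z. b i y * x y)" for i
    proof -
      have "(\<Sum>y\<in>Y. b i y * (x(z := t)) y) = b i z * t + (\<Sum>y\<in>?Z. b i y * (x(z := t)) y)"
        using Suc.prems z by (subst sum.remove[of _ z]) auto
      also have "(\<Sum>y\<in>?Z. b i y * (x(z := t)) y) = (\<Sum>y\<in>?Z. b i y * x y)"
        by (rule sum.cong) auto
      finally show ?thesis .
    qed
    have "(\<Sum>y\<in>Y. b i y * (x(z := t)) y) = 0" if "i < Suc r" for i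
    proof (cases "i = r")
      case True
      then show ?thesis using z unfolding split by (simp add: t_def)
    next
      case False
      have "(\<Sum>y\<in>?Z. c i y * x y) = (\<Sum>y\<in>?Z. b i y * x y) - (b i z / b r z) * (\<Sum>y\<in>?Z. b r y * x y)"
        by (simp add: c_def left_diff_distrib right_diff_distrib sum_subtractf sum_distrib_left mult_ac)
      moreover have "(\<Sum>y\<in>?Z. c i y * x y) = 0" using x(2) that False by simp
      ultimately show ?thesis unfolding split by (simp add: t_def)
    qed
    then show ?thesis using x(1) by (intro exI[of _ "x(z := t)"]) auto
  qed
qed

text \<open>
  Strict diagonal dominance: at an index where \<open>x\<close> has maximal modulus, \<open>x = - (N - 1) x\<close>
  would have strictly smaller modulus unless \<open>x = 0\<close>.
\<close>

lemma nonsingular_near_identity: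
  fixes N :: "'y \<Rightarrow> 'y \<Rightarrow> complex"
  assumes "finite Y"
    and near: "\<And>y z. y \<in> Y \<Longrightarrow> z \<in> Y \<Longrightarrow> dist (N y z) (if y = z then 1 else 0) < 1 / card Y"
    and ker: "\<And>y. y \<in> Y \<Longrightarrow> (\<Sum>z\<in>Y. N y z * x z) = 0"
    and "y \<in> Y"
  shows "x y = 0"
proof -
  have "Y \<noteq> {}" using assms(4) by auto
  then have "\<exists>m\<in>Y. \<forall>z\<in>Y. norm (x z) \<le> norm (x m)"
    using arg_min_if_finite[OF assms(1), of "\<lambda>z. - norm (x z)"] by (metis leI neg_less_iff_less)
  then obtain m where m: "m \<in> Y" "\<And>z. z \<in> Y \<Longrightarrow> norm (x z) \<le> norm (x m)" by blast
  have "norm (x m) = 0"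
  proof (rule ccontr)
    assume "norm (x m) \<noteq> 0"
    then have pos: "norm (x m) > 0" by simp
    let ?d = "\<lambda>z. N m z - (if m = z then 1 else 0)"
    have "(\<Sum>z\<in>Y. ?d z * x z) = (\<Sum>z\<in>Y. N m z * x z) - (\<Sum>z\<in>Y. if m = z then x z else 0)"
      unfolding sum_subtractf[symmetric] by (rule sum.cong) (auto simp: algebra_simps)
    also have "\<dots> = - x m" using ker[OF m(1)] m(1) assms(1) by simp
    finally have "norm (x m) = norm (\<Sum>z\<in>Y. ?d z * x z)" by simp
    also have "\<dots> \<le> (\<Sum>z\<in>Y. norm (?d z) * norm (x z))"
      by (rule order_trans[OF norm_sum]) (simp add: norm_mult)
    also have "\<dots> < (\<Sum>z\<in>Y. 1 / card Y * norm (x m))"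
    proof (rule sum_strict_mono[OF assms(1) \<open>Y \<noteq> {}\<close>])
      fix z assume z: "z \<in> Y"
      have "norm (?d z) * norm (x z) \<le> norm (?d z) * norm (x m)"
        using m(2)[OF z] by (rule mult_left_mono) simp
      also have "\<dots> < 1 / card Y * norm (x m)"
        using near[OF m(1) z] pos by (intro mult_strict_right_mono) (simp_all add: dist_norm)
      finally show "norm (?d z) * norm (x z) < 1 / card Y * norm (x m)" .
    qed
    also have "\<dots> = norm (x m)" using assms(1) \<open>Y \<noteq> {}\<close> by simp
    finally show False by simp
  qed
  then show ?thesis using m(2)[OF assms(4)] by simp
qed

text \<open>
  Here \<open>c y\<close> prescribes the coordinates outside factor \<open>p\<close>, so \<open>S ((c y)[p := z])\<close> is a square
  submatrix of the flattening to factor \<open>p\<close>. With fewer than \<open>card Y\<close> simple tensors, some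
  nonzero vector is annihilated by all their factors \<open>p\<close>, hence by this submatrix, which is
  too close to the identity for that.
\<close>

lemma tensor_rank_ge_flattening:
  assumes "Is \<noteq> []" "\<forall>I \<in> set Is. finite I" "S \<in> tensor_space Is"
    and "p < length Is" "finite Y" "\<And>y. y \<in> Y \<Longrightarrow> length (c y) = length Is"
    and near: "\<And>y z. y \<in> Y \<Longrightarrow> z \<in> Y \<Longrightarrow>
      dist (S ((c y)[p := z])) (if y = z then 1 else 0) < 1 / card Y"
  shows "card Y \<le> tensor_rank Is S"
proof (rule ccontr)
  define r where "r = tensor_rank Is S"
  assume "\<not> card Y \<le> tensor_rank Is S"
  then have less: "r < card Y" by (simp add: r_def)
  obtain v where v: "\<And>i. i < r \<Longrightarrow> v i \<in> listset (map vec_space Is)"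
    and S_eq: "S = (\<lambda>xs. \<Sum>i<r. simple_tensor (v i) xs)"
    using tensor_rank_attained[OF assms(1-3)] unfolding r_def by blast
  have len: "length (v i) = length Is" if "i < r" for i
    using v[OF that] by (auto simp: mem_listset_iff list_all2_conv_all_nth)
  obtain x where x: "\<exists>y\<in>Y. x y \<noteq> 0" "\<And>i. i < r \<Longrightarrow> (\<Sum>z\<in>Y. (v i ! p) z * x z) = 0"
    using underdetermined_system_solvable[OF assms(5) less, of "\<lambda>i. v i ! p"] by blast
  have "(\<Sum>z\<in>Y. S ((c y)[p := z]) * x z) = 0" if y: "y \<in> Y" for y
  proof -
    let ?q = "\<lambda>i. \<Prod>j \<in> {..<length (v i)} - {p}. (v i ! j) (c y ! j)"
    have "(\<Sum>z\<in>Y. S ((c y)[p := z]) * x z) = (\<Sum>z\<in>Y. \<Sum>i<r. ?q i * ((v i ! p) z * x z))"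
      using len assms(4) assms(6)[OF y]
      by (intro sum.cong) (simp_all add: S_eq simple_tensor_update sum_distrib_left sum_distrib_right mult_ac)
    also have "\<dots> = (\<Sum>i<r. \<Sum>z\<in>Y. ?q i * ((v i ! p) z * x z))"
      by (rule sum.swap)
    also have "\<dots> = (\<Sum>i<r. ?q i * (\<Sum>z\<in>Y. (v i ! p) z * x z))"
      by (simp add: sum_distrib_left)
    also have "\<dots> = 0" using x(2) by simp
    finally show ?thesis .
  qed
  then have "\<forall>y\<in>Y. x y = 0"
    using nonsingular_near_identity[OF assms(5), of "\<lambda>y z. S ((c y)[p := z])" x] near by auto
  then show False using x(1) by blast
qed

section \<open>Border rank\<close>

text \<open>
  A flattening of \<open>T\<close> that contains an identity matrix of size \<open>card Y\<close> bounds the rank of all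
  tensors near \<open>T\<close> from below; sums of \<open>card Y\<close> simple tensors that converge to \<open>T\<close> then have rank
  exactly \<open>card Y\<close> near \<open>\<epsilon> = 0\<close>.
\<close>

lemma border_rank_eqI:
  fixes v :: "complex \<Rightarrow> 'k \<Rightarrow> ('i \<Rightarrow> complex) list"
  assumes "Is \<noteq> []" and fin: "\<forall>I \<in> set Is. finite I"
    and p: "p < length Is" and Y: "Y \<subseteq> Is ! p" and c: "\<And>y. y \<in> Y \<Longrightarrow> c y \<in> listset Is"
    and T: "\<And>y z. y \<in> Y \<Longrightarrow> z \<in> Y \<Longrightarrow> T ((c y)[p := z]) = (if y = z then 1 else 0)"
    and K: "finite K" "card K = card Y"
    and v: "\<And>\<epsilon> t. t \<in> K \<Longrightarrow> v \<epsilon> t \<in> listset (map vec_space Is)"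
    and lim: "\<And>xs. xs \<in> listset Is \<Longrightarrow>
      ((\<lambda>\<epsilon>. \<Sum>t\<in>K. simple_tensor (v \<epsilon> t) xs) \<longlongrightarrow> T xs) (at 0)"
  shows "border_rank Is T = card Y"
proof -
  let ?L = "listset Is"
  define G where "G \<epsilon> = (\<lambda>xs. \<Sum>t\<in>K. simple_tensor (v \<epsilon> t) xs)" for \<epsilon> :: complex
  have finL: "finite ?L" using fin by (rule finite_listset)
  have finY: "finite Y" using p Y fin by (meson finite_subset nth_mem)
  have c': "(c y)[p := z] \<in> ?L" if "y \<in> Y" "z \<in> Y" for y z
    using c[OF that(1)] that(2) Y p
    by (auto simp: mem_listset_iff list_all2_conv_all_nth nth_list_update)
  have c_len: "length (c y) = length Is" if "y \<in> Y" for y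
    using c[OF that] by (auto simp: mem_listset_iff list_all2_conv_all_nth)
  have lower: "\<forall>\<^sub>F \<epsilon> in at 0. card Y \<le> tensor_rank Is (F \<epsilon>)"
    if mem: "\<And>\<epsilon>. \<epsilon> \<noteq> 0 \<Longrightarrow> F \<epsilon> \<in> tensor_space Is"
      and F: "\<And>xs. xs \<in> ?L \<Longrightarrow> ((\<lambda>\<epsilon>. F \<epsilon> xs) \<longlongrightarrow> T xs) (at 0)" for F :: "complex \<Rightarrow> _"
  proof (cases "Y = {}")
    case False
    have "\<forall>\<^sub>F \<epsilon> in at 0. \<forall>xs\<in>?L. dist (F \<epsilon> xs) (T xs) < 1 / card Y"
      using False finY by (intro eventually_ball_finite[OF finL] ballI tendstoD[OF F])
        (auto simp: card_gt_0_iff)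
    moreover have "\<forall>\<^sub>F \<epsilon> in at (0::complex). \<epsilon> \<noteq> 0"
      by (simp add: eventually_at_filter)
    ultimately show ?thesis
    proof eventually_elim
      case (elim \<epsilon>)
      show ?case
      proof (rule tensor_rank_ge_flattening[OF assms(1) fin mem[OF elim(2)] p finY c_len])
        fix y z assume "y \<in> Y" "z \<in> Y"
        then show "dist (F \<epsilon> ((c y)[p := z])) (if y = z then 1 else 0) < 1 / card Y"
          using elim(1) c' T by metis
      qed
    qed
  qed simp
  have G_mem: "G \<epsilon> \<in> tensor_space Is" for \<epsilon>
    using simple_tensor_zero_outside[OF v] by (auto simp: G_def tensor_space_def intro!: sum.neutral)
  have G_le: "tensor_rank Is (G \<epsilon>) \<le> card Y" for \<epsilon>
    unfolding G_def using tensor_rank_le_card[OF K(1) v] K(2) by simp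
  have "\<forall>\<^sub>F \<epsilon> in at 0. card Y \<le> tensor_rank Is (G \<epsilon>)"
    using lower[of G] G_mem lim by (simp add: G_def)
  then obtain d where d: "d > 0" "\<And>\<epsilon>. \<epsilon> \<noteq> 0 \<Longrightarrow> dist \<epsilon> 0 < d \<Longrightarrow> card Y \<le> tensor_rank Is (G \<epsilon>)"
    by (auto simp: eventually_at)
  \<comment> \<open>The definition of border rank asks for the exact rank at every \<open>\<epsilon> \<noteq> 0\<close>, which is known only
    for small \<open>\<epsilon>\<close>; away from 0 the family is replaced by one of its members of the right rank.\<close>
  define H where "H \<epsilon> = (if dist \<epsilon> 0 < d then G \<epsilon> else G (complex_of_real (d / 2)))" for \<epsilon>
  have H_rank: "tensor_rank Is (H \<epsilon>) = card Y" if "\<epsilon> \<noteq> 0" for \<epsilon>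
    using d(1) d(2)[OF that] d(2)[of "complex_of_real (d / 2)"] G_le
    by (auto simp: H_def intro!: antisym)
  have "((\<lambda>\<epsilon>. H \<epsilon> xs) \<longlongrightarrow> T xs) (at 0)" if "xs \<in> ?L" for xs
  proof (rule Lim_transform_eventually)
    show "((\<lambda>\<epsilon>. G \<epsilon> xs) \<longlongrightarrow> T xs) (at 0)" using lim[OF that] by (simp add: G_def)
    show "\<forall>\<^sub>F \<epsilon> in at 0. G \<epsilon> xs = H \<epsilon> xs"
      using d(1) by (auto simp: eventually_at H_def)
  qed
  then have "((\<lambda>\<epsilon>. sqrt (\<Sum>xs\<in>?L. (dist (H \<epsilon> xs) (T xs))\<^sup>2)) \<longlongrightarrow> sqrt (\<Sum>xs\<in>?L. (dist (T xs) (T xs))\<^sup>2)) (at 0)"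
    by (intro tendsto_real_sqrt tendsto_sum tendsto_power tendsto_dist tendsto_const)
  then have H_lim: "((\<lambda>\<epsilon>. tensor_dist Is (H \<epsilon>) T) \<longlongrightarrow> 0) (at 0)"
    by (simp add: tensor_dist_def L2_set_def)
  show ?thesis
    unfolding border_rank_def
  proof (rule Least_equality)
    show "\<exists>F :: complex \<Rightarrow> _. (\<forall>\<epsilon>. \<epsilon> \<noteq> 0 \<longrightarrow> F \<epsilon> \<in> tensor_space Is \<and> tensor_rank Is (F \<epsilon>) = card Y) \<and>
        ((\<lambda>\<epsilon>. tensor_dist Is (F \<epsilon>) T) \<longlongrightarrow> 0) (at 0)"
      using H_rank H_lim G_mem by (intro exI[of _ H]) (auto simp: H_def)
  next
    fix r
    assume "\<exists>F :: complex \<Rightarrow> _. (\<forall>\<epsilon>. \<epsilon> \<noteq> 0 \<longrightarrow> F \<epsilon> \<in> tensor_space Is \<and> tensor_rank Is (F \<epsilon>) = r) \<and>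
        ((\<lambda>\<epsilon>. tensor_dist Is (F \<epsilon>) T) \<longlongrightarrow> 0) (at 0)"
    then obtain F :: "complex \<Rightarrow> _" where F: "\<And>\<epsilon>. \<epsilon> \<noteq> 0 \<Longrightarrow> F \<epsilon> \<in> tensor_space Is"
        "\<And>\<epsilon>. \<epsilon> \<noteq> 0 \<Longrightarrow> tensor_rank Is (F \<epsilon>) = r"
        "((\<lambda>\<epsilon>. tensor_dist Is (F \<epsilon>) T) \<longlongrightarrow> 0) (at 0)" by auto
    have "((\<lambda>\<epsilon>. F \<epsilon> xs) \<longlongrightarrow> T xs) (at 0)" if "xs \<in> ?L" for xs
    proof -
      have "dist (F \<epsilon> xs) (T xs) \<le> tensor_dist Is (F \<epsilon>) T" for \<epsilon>
        unfolding tensor_dist_def using finL that by (intro member_le_L2_set) auto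
      then have "((\<lambda>\<epsilon>. dist (F \<epsilon> xs) (T xs)) \<longlongrightarrow> 0) (at 0)"
        by (intro tendsto_sandwich[OF _ _ tendsto_const F(3)]) auto
      then show ?thesis by (rule iffD2[OF tendsto_dist_iff])
    qed
    from lower[OF F(1) this] have "\<forall>\<^sub>F \<epsilon> in at (0::complex). card Y \<le> tensor_rank Is (F \<epsilon>)" by auto
    moreover have "\<forall>\<^sub>F \<epsilon> in at (0::complex). \<epsilon> \<noteq> 0"
      by (simp add: eventually_at_filter)
    ultimately have "\<forall>\<^sub>F \<epsilon> in at (0::complex). card Y \<le> r"
      by eventually_elim (simp add: F(2))
    then show "card Y \<le> r" by simp
  qed
qed

section \<open>The two summands\<close>

definition triples :: "nat \<Rightarrow> (nat \<times> nat \<times> nat) set" where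
  "triples a = {1..2} \<times> {1..2} \<times> {1..a+2}"

lemma finite_triples [simp]: "finite (triples a)"
  by (simp add: triples_def)

lemma card_triples: "card (triples a) = 4 * (a + 2)"
  by (simp add: triples_def card_cartesian_product)

lemma sum_triples:
  "(\<Sum>(i, j, k)\<in>triples a. f i j k) = (\<Sum>i=1..2. \<Sum>j=1..2. \<Sum>k=1..a+2. f i j k)"
  by (simp only: triples_def sum.cartesian_product)

lemma sum_1_to_2: "(\<Sum>i=1..2::nat. f i) = f 1 + f 2"
  by (simp add: numeral_2_eq_2)

definition V4_basis :: "nat \<Rightarrow> nat list set" where
  "V4_basis a = (\<lambda>(i, j, k). [i, j, k]) ` triples a"

lemma finite_V4_basis [simp]: "finite (V4_basis a)"
  by (simp add: V4_basis_def)

lemma mem_V4_basis_iff [simp]: "[i, j, k] \<in> V4_basis a \<longleftrightarrow> (i, j, k) \<in> triples a"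
  by (force simp: V4_basis_def)

lemma V4_basisE:
  assumes "y \<in> V4_basis a"
  obtains i j k where "y = [i, j, k]" "(i, j, k) \<in> triples a"
  using assms by (auto simp: V4_basis_def)

lemma card_V4_basis: "card (V4_basis a) = 4 * (a + 2)"
  unfolding V4_basis_def card_triples[symmetric] by (rule card_image) (auto simp: inj_on_def)

lemma V_spaces_eq:
  "V_spaces a = [(\<lambda>i. [i]) ` {1..2}, (\<lambda>i. [i]) ` {1..2}, (\<lambda>i. [i]) ` {1..a+2}, V4_basis a]"
  by (force simp: V_spaces_def V4_basis_def triples_def)

lemma T1_eq:
  "T1 a xs = (\<Sum>(i, j, k)\<in>triples a.
     simple_tensor [basis_vec [i], basis_vec [j], basis_vec [k], basis_vec [i, j, k]] xs)"
  by (simp add: T1_def sum_triples)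

text \<open>
  The fourth index of a nonzero coordinate of \<open>T1\<close> determines the other three and is determined
  by them: this is the identity matrix in the flattening of \<open>T1\<close> to the fourth factor.
\<close>

lemma T1_at_node:
  assumes "(i, j, k) \<in> triples a"
  shows "T1 a [[i], [j], [k], y] = (if y = [i, j, k] then 1 else 0)"
proof -
  have "T1 a [[i], [j], [k], y] = (\<Sum>t\<in>triples a. if t = (i, j, k) then basis_vec [i, j, k] y else 0)"
    unfolding T1_eq by (rule sum.cong) (auto simp: simple_tensor_4 basis_vec_def split: if_splits)
  then show ?thesis using assms by (simp add: basis_vec_def)
qed

lemma T2_at: "T2 a [x1, x2, x3, x4] =
    (if x1 = x2 \<and> x1 \<in> {1..a} \<and> x3 = 1 \<and> x4 = 1 then 1 else 0)"
proof -
  have "T2 a [x1, x2, x3, x4] =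
      (\<Sum>j=1..a. if j = x1 then (if x1 = x2 \<and> x3 = 1 \<and> x4 = 1 then 1 else 0) else 0)"
    unfolding T2_def by (rule sum.cong) (auto simp: simple_tensor_4 basis_vec_def)
  then show ?thesis by simp
qed

lemma border_rank_T1: "border_rank (V_spaces a) (T1 a) = 4 * (a + 2)"
proof -
  have "border_rank (V_spaces a) (T1 a) = card (V4_basis a)"
  proof (rule border_rank_eqI[where p = 3 and c = "\<lambda>y. [[y ! 0], [y ! 1], [y ! 2], y]"
        and K = "triples a" and v = "\<lambda>\<epsilon> (i, j, k). [basis_vec [i], basis_vec [j], basis_vec [k], basis_vec [i, j, k]]"])
    show "[[y ! 0], [y ! 1], [y ! 2], y] \<in> listset (V_spaces a)" if "y \<in> V4_basis a" for y
      using that by (auto simp: V_spaces_eq mem_listset_iff V4_basis_def triples_def simp del: listset.simps)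
    show "T1 a ([[y ! 0], [y ! 1], [y ! 2], y][3 := z]) = (if y = z then 1 else 0)"
      if "y \<in> V4_basis a" for y z
      using that by (auto simp: V4_basis_def T1_at_node)
  next
    fix xs
    show "((\<lambda>\<epsilon>. \<Sum>t\<in>triples a. simple_tensor (case t of (i, j, k) \<Rightarrow>
        [basis_vec [i], basis_vec [j], basis_vec [k], basis_vec [i, j, k]]) xs) \<longlongrightarrow> T1 a xs) (at (0::complex))"
      by (simp add: T1_eq case_prod_beta')
  qed (auto simp: V_spaces_eq mem_listset_iff vec_space_def basis_vec_def card_V4_basis card_triples
      simp del: listset.simps, auto simp: triples_def)
  then show ?thesis by (simp add: card_V4_basis)
qed

lemma border_rank_T2: "border_rank (W_spaces a) (T2 a) = a"
proof -
  have "border_rank (W_spaces a) (T2 a) = card {1..a}"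
  proof (rule border_rank_eqI[where p = 0 and c = "\<lambda>y. [y, y, 1, 1]"
        and K = "{1..a}" and v = "\<lambda>\<epsilon> j. [basis_vec j, basis_vec j, basis_vec 1, basis_vec 1]"])
    fix xs
    show "((\<lambda>\<epsilon>. \<Sum>j\<in>{1..a}. simple_tensor [basis_vec j, basis_vec j, basis_vec 1, basis_vec 1] xs)
        \<longlongrightarrow> T2 a xs) (at (0::complex))"
      by (simp add: T2_def)
  qed (auto simp: W_spaces_def T2_at mem_listset_iff vec_space_def basis_vec_def simp del: listset.simps)
  then show ?thesis by simp
qed

section \<open>The direct sum\<close>

lemma basis_vec_sum_simps [simp]:
  "basis_vec (Inl u) (Inl x) = basis_vec u x"
  "basis_vec (Inr w) (Inr y) = basis_vec w y"
  "basis_vec (Inl u) (Inr y) = 0"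
  "basis_vec (Inr w) (Inl x) = 0"
  by (simp_all add: basis_vec_def)

lemma Inl_Inr_disjoint: "Inl x \<notin> range Inr" "Inr y \<notin> range Inl"
  by auto

lemma direct_sum_T1_T2:
  "direct_sum (T1 a) (T2 a) [z1, z2, z3, z4] =
     (\<Sum>(i, j, k)\<in>triples a. basis_vec (Inl [i]) z1 * basis_vec (Inl [j]) z2 *
        basis_vec (Inl [k]) z3 * basis_vec (Inl [i, j, k]) z4) +
     (\<Sum>l=1..a. basis_vec (Inr l) z1 * basis_vec (Inr l) z2) *
        basis_vec (Inr 1) z3 * basis_vec (Inr 1) z4"
  by (cases z1; cases z2; cases z3; cases z4)
    (simp_all add: direct_sum_def Inl_Inr_disjoint T1_eq T2_def simple_tensor_4 sum_distrib_right case_prod_beta')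

text \<open>
  The scalars \<open>\<gamma>\<^sub>k\<close> and vectors \<open>\<alpha>\<^sub>k\<close>, \<open>\<beta>\<^sub>k\<close> of the construction. For \<open>k \<le> a\<close> both vectors are
  \<open>w\<^sub>k\<close>, which already yields \<open>\<Sum> w\<^sub>l \<otimes> w\<^sub>l\<close>. The remaining two indices only serve to make the
  weighted sums vanish: one corrects \<open>\<alpha>\<close>, the other \<open>\<beta>\<close>, so that neither contributes to
  \<open>\<Sum> \<gamma>\<^sub>k \<alpha>\<^sub>k \<otimes> \<beta>\<^sub>k\<close>.
\<close>

definition weight :: "nat \<Rightarrow> nat \<Rightarrow> complex" where
  "weight a k = (if k = a + 2 then - of_nat (a + 1) else 1)"

definition left_vec :: "nat \<Rightarrow> nat \<Rightarrow> 'i + nat \<Rightarrow> complex" where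
  "left_vec a k z = (if k \<le> a then basis_vec (Inr k) z
     else if k = a + 1 then - (\<Sum>l=1..a. basis_vec (Inr l) z) else 0)"

definition right_vec :: "nat \<Rightarrow> nat \<Rightarrow> 'i + nat \<Rightarrow> complex" where
  "right_vec a k z = (if k \<le> a then basis_vec (Inr k) z
     else if k = a + 2 then (\<Sum>l=1..a. basis_vec (Inr l) z) / of_nat (a + 1) else 0)"

lemma sum_last_two:
  fixes f :: "nat \<Rightarrow> complex"
  shows "(\<Sum>k=1..a+2. f k) = (\<Sum>k=1..a. f k) + f (a + 1) + f (a + 2)"
  by simp

lemma sum_weight: "(\<Sum>k=1..a+2. weight a k) = 0"
proof -
  have "(\<Sum>k=1..a. weight a k) = (\<Sum>k=1..a. 1)" by (rule sum.cong) (auto simp: weight_def)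
  then show ?thesis unfolding sum_last_two by (simp add: weight_def)
qed

lemma sum_weight_left: "(\<Sum>k=1..a+2. weight a k * left_vec a k z) = 0"
proof -
  have "(\<Sum>k=1..a. weight a k * left_vec a k z) = (\<Sum>k=1..a. basis_vec (Inr k) z)"
    by (rule sum.cong) (auto simp: weight_def left_vec_def)
  then show ?thesis unfolding sum_last_two by (simp add: weight_def left_vec_def)
qed

lemma sum_weight_right: "(\<Sum>k=1..a+2. weight a k * right_vec a k z) = 0"
proof -
  have "(\<Sum>k=1..a. weight a k * right_vec a k z) = (\<Sum>k=1..a. basis_vec (Inr k) z)"
    by (rule sum.cong) (auto simp: weight_def right_vec_def)
  moreover have "complex_of_nat (a + 1) \<noteq> 0" unfolding of_nat_eq_0_iff by simp
  ultimately show ?thesis unfolding sum_last_two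
    by (simp add: weight_def right_vec_def del: of_nat_Suc of_nat_add)
qed

lemma sum_weight_left_right:
  "(\<Sum>k=1..a+2. weight a k * left_vec a k z * right_vec a k z') =
     (\<Sum>l=1..a. basis_vec (Inr l) z * basis_vec (Inr l) z')"
proof -
  have "(\<Sum>k=1..a. weight a k * left_vec a k z * right_vec a k z') =
      (\<Sum>l=1..a. basis_vec (Inr l) z * basis_vec (Inr l) z')"
    by (rule sum.cong) (auto simp: weight_def left_vec_def right_vec_def)
  then show ?thesis unfolding sum_last_two by (simp add: left_vec_def right_vec_def)
qed

definition sgn_of :: "nat \<Rightarrow> complex" where
  "sgn_of i = (if i = 1 then 1 else - 1)"

text \<open>
  The coordinates of \<open>P\<close> are expanded for arbitrary coordinate values. The sum over the four
  sign patterns removes the contributions of \<open>\<alpha>\<close> alone, of \<open>\<beta>\<close> alone and of \<open>\<alpha> \<beta>\<close>; each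
  of the other terms of degree 1 or 2 carries one of the three vanishing sums as a factor.
\<close>

lemma perturbed_product_expansion:
  fixes x y z \<alpha> \<beta> \<gamma> :: "nat \<Rightarrow> complex"
  assumes "(\<Sum>k=1..a+2. \<gamma> k) = 0" "(\<Sum>k=1..a+2. \<gamma> k * \<alpha> k) = 0" "(\<Sum>k=1..a+2. \<gamma> k * \<beta> k) = 0"
  shows "(\<Sum>(i, j, k)\<in>triples a. (x i + \<epsilon> * sgn_of i * \<alpha> k) * (y j + \<epsilon> * sgn_of j * \<beta> k) *
            (z k + \<epsilon> * sgn_of i * sgn_of j * \<gamma> k / 4 * w)) =
         (\<Sum>i=1..2. x i) * (\<Sum>j=1..2. y j) * (\<Sum>k=1..a+2. z k) +
         \<epsilon> ^ 3 * (\<Sum>k=1..a+2. \<gamma> k * \<alpha> k * \<beta> k) * w"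
proof -
  let ?f = "\<lambda>i j k. (x i + \<epsilon> * sgn_of i * \<alpha> k) * (y j + \<epsilon> * sgn_of j * \<beta> k) *
            (z k + \<epsilon> * sgn_of i * sgn_of j * \<gamma> k / 4 * w)"
  have "(\<Sum>(i, j, k)\<in>triples a. ?f i j k) =
      (\<Sum>k=1..a+2. ?f 1 1 k + ?f 1 2 k + ?f 2 1 k + ?f 2 2 k)"
    unfolding sum_triples sum_1_to_2 by (simp only: sum.distrib add.assoc)
  also have "\<dots> = (\<Sum>k=1..a+2. (x 1 + x 2) * (y 1 + y 2) * z k
      + \<epsilon> * w / 4 * (x 1 - x 2) * (y 1 - y 2) * \<gamma> k
      + \<epsilon>\<^sup>2 * w / 2 * (y 1 - y 2) * (\<gamma> k * \<alpha> k)
      + \<epsilon>\<^sup>2 * w / 2 * (x 1 - x 2) * (\<gamma> k * \<beta> k)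
      + \<epsilon> ^ 3 * w * (\<gamma> k * \<alpha> k * \<beta> k))"
    by (rule sum.cong) (simp_all add: sgn_of_def field_simps power2_eq_square power3_eq_cube)
  also have "\<dots> = (x 1 + x 2) * (y 1 + y 2) * (\<Sum>k=1..a+2. z k)
      + \<epsilon> ^ 3 * w * (\<Sum>k=1..a+2. \<gamma> k * \<alpha> k * \<beta> k)"
    using assms by (simp only: sum.distrib sum_distrib_left[symmetric]) simp
  finally show ?thesis unfolding sum_1_to_2 by (simp only: mult_ac)
qed

text \<open>
  The constructor \<open>Some\<close> tags the terms of \<open>P\<close> with their fourth factor, and \<open>None\<close> the single
  correction term \<open>- \<epsilon>\<^sup>-\<^sup>3 Q \<otimes> w\<close>.
\<close>

definition approx_factors ::
  "nat \<Rightarrow> complex \<Rightarrow> (nat \<times> nat \<times> nat) option \<Rightarrow> (nat list + nat \<Rightarrow> complex) list" where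
  "approx_factors a \<epsilon> t = (case t of
     Some (i, j, k) \<Rightarrow>
       [\<lambda>z. basis_vec (Inl [i]) z + \<epsilon> * sgn_of i * left_vec a k z,
        \<lambda>z. basis_vec (Inl [j]) z + \<epsilon> * sgn_of j * right_vec a k z,
        \<lambda>z. basis_vec (Inl [k]) z + \<epsilon> * sgn_of i * sgn_of j * weight a k / 4 * basis_vec (Inr 1) z,
        \<lambda>z. basis_vec (Inl [i, j, k]) z + 1 / \<epsilon> ^ 3 * basis_vec (Inr 1) z]
   | None \<Rightarrow>
       [\<lambda>z. \<Sum>i=1..2. basis_vec (Inl [i]) z, \<lambda>z. \<Sum>j=1..2. basis_vec (Inl [j]) z,
        \<lambda>z. \<Sum>k=1..a+2. basis_vec (Inl [k]) z, \<lambda>z. - 1 / \<epsilon> ^ 3 * basis_vec (Inr 1) z])"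

text \<open>
  All negative powers of \<open>\<epsilon>\<close> sit at \<open>w\<close> in the fourth factor, and there the
  expansion of \<open>P\<close> leaves exactly \<open>T2\<close>. What remains is polynomial in \<open>\<epsilon>\<close>.
\<close>

lemma sum_approx_factors:
  assumes "\<epsilon> \<noteq> 0"
  shows "(\<Sum>t\<in>insert None (Some ` triples a). simple_tensor (approx_factors a \<epsilon> t) [z1, z2, z3, z4]) =
    (\<Sum>(i, j, k)\<in>triples a. (basis_vec (Inl [i]) z1 + \<epsilon> * sgn_of i * left_vec a k z1) *
        (basis_vec (Inl [j]) z2 + \<epsilon> * sgn_of j * right_vec a k z2) *
        (basis_vec (Inl [k]) z3 + \<epsilon> * sgn_of i * sgn_of j * weight a k / 4 * basis_vec (Inr 1) z3) *
        basis_vec (Inl [i, j, k]) z4) +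
    (\<Sum>l=1..a. basis_vec (Inr l) z1 * basis_vec (Inr l) z2) * basis_vec (Inr 1) z3 * basis_vec (Inr 1) z4"
  (is "?lhs = ?A + ?B")
proof -
  let ?P = "\<lambda>i j k. (basis_vec (Inl [i]) z1 + \<epsilon> * sgn_of i * left_vec a k z1) *
        (basis_vec (Inl [j]) z2 + \<epsilon> * sgn_of j * right_vec a k z2) *
        (basis_vec (Inl [k]) z3 + \<epsilon> * sgn_of i * sgn_of j * weight a k / 4 * basis_vec (Inr 1) z3)"
  let ?Q = "(\<Sum>i=1..2. basis_vec (Inl [i]) z1) * (\<Sum>j=1..2. basis_vec (Inl [j]) z2) *
        (\<Sum>k=1..a+2. basis_vec (Inl [k]) z3) :: complex"
  let ?e = "1 / \<epsilon> ^ 3 * basis_vec (Inr 1) z4"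
  have key: "(\<Sum>(i, j, k)\<in>triples a. ?P i j k) =
      ?Q + \<epsilon> ^ 3 * (\<Sum>l=1..a. basis_vec (Inr l) z1 * basis_vec (Inr l) z2) * basis_vec (Inr 1) z3"
    using perturbed_product_expansion[OF sum_weight sum_weight_left sum_weight_right]
    by (simp only: sum_weight_left_right)
  have split: "(\<Sum>(i, j, k)\<in>triples a. p i j k * (q i j k + e)) =
      (\<Sum>(i, j, k)\<in>triples a. p i j k * q i j k) + (\<Sum>(i, j, k)\<in>triples a. p i j k) * e"
    for p q :: "nat \<Rightarrow> nat \<Rightarrow> nat \<Rightarrow> complex" and e
    by (simp add: distrib_left case_prod_beta' sum.distrib sum_distrib_right)
  have "?lhs = - ?Q * ?e + (\<Sum>(i, j, k)\<in>triples a. ?P i j k * (basis_vec (Inl [i, j, k]) z4 + ?e))"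
    by (subst sum.insert)
      (auto simp: sum.reindex approx_factors_def simple_tensor_4 intro!: sum.cong)
  also have "\<dots> = - ?Q * ?e + (?A + (\<Sum>(i, j, k)\<in>triples a. ?P i j k) * ?e)"
    by (simp only: split)
  also have "\<dots> = ?A + ?B"
    using assms unfolding key by (simp add: field_simps)
  finally show ?thesis .
qed

lemma basis_vec_mem_vec_space: "i \<in> I \<Longrightarrow> basis_vec i \<in> vec_space I"
  by (auto simp: basis_vec_def vec_space_def)

lemma vec_space_add: "u \<in> vec_space I \<Longrightarrow> v \<in> vec_space I \<Longrightarrow> (\<lambda>z. u z + v z) \<in> vec_space I"
  by (simp add: vec_space_def)

lemma vec_space_scale: "v \<in> vec_space I \<Longrightarrow> (\<lambda>z. c * v z) \<in> vec_space I"
  by (simp add: vec_space_def)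

lemma vec_space_sum: "(\<And>t. t \<in> K \<Longrightarrow> v t \<in> vec_space I) \<Longrightarrow> (\<lambda>z. \<Sum>t\<in>K. v t z) \<in> vec_space I"
  by (simp add: vec_space_def)

lemma left_vec_mem: "Inr ` {1..a} \<subseteq> I \<Longrightarrow> k \<ge> 1 \<Longrightarrow> left_vec a k \<in> vec_space I"
  by (auto simp: left_vec_def vec_space_def basis_vec_def intro!: sum.neutral)

lemma right_vec_mem: "Inr ` {1..a} \<subseteq> I \<Longrightarrow> k \<ge> 1 \<Longrightarrow> right_vec a k \<in> vec_space I"
  by (auto simp: right_vec_def vec_space_def basis_vec_def intro!: sum.neutral)

lemma sum_spaces_eq:
  "sum_spaces (V_spaces a) (W_spaces a) =
     [(\<lambda>i. [i]) ` {1..2} <+> {1..a}, (\<lambda>i. [i]) ` {1..2} <+> {1..a},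
      (\<lambda>i. [i]) ` {1..a+2} <+> {1}, V4_basis a <+> {1}]"
  by (simp add: sum_spaces_def V_spaces_eq W_spaces_def)

lemma approx_factors_mem:
  assumes "t \<in> insert None (Some ` triples a)"
  shows "approx_factors a \<epsilon> t \<in> listset (map vec_space (sum_spaces (V_spaces a) (W_spaces a)))"
proof (cases t)
  case None
  show ?thesis
    unfolding None approx_factors_def sum_spaces_eq mem_listset_iff option.case list.map list_all2_Cons
    by (intro conjI vec_space_sum vec_space_scale basis_vec_mem_vec_space) auto
next
  case (Some ijk)
  obtain i j k where ijk: "ijk = (i, j, k)" by (cases ijk)
  then have mem: "(i, j, k) \<in> triples a" using assms Some by auto
  then have "[i, j, k] \<in> V4_basis a" by (force simp: V4_basis_def)
  moreover have "i \<in> {1..2}" "j \<in> {1..2}" "k \<in> {1..a+2}" using mem by (auto simp: triples_def)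
  ultimately show ?thesis
    unfolding Some ijk approx_factors_def sum_spaces_eq mem_listset_iff option.case prod.case
      list.map list_all2_Cons
    by (intro conjI vec_space_add vec_space_scale basis_vec_mem_vec_space left_vec_mem right_vec_mem)
      auto
qed

lemma border_rank_direct_sum:
  "border_rank (sum_spaces (V_spaces a) (W_spaces a)) (direct_sum (T1 a) (T2 a)) = 4 * (a + 2) + 1"
  if "a \<ge> 1"
proof -
  let ?Is = "sum_spaces (V_spaces a) (W_spaces a)" and ?T = "direct_sum (T1 a) (T2 a)"
  let ?K = "insert None (Some ` triples a)" and ?Y = "Inl ` V4_basis a \<union> {Inr (1::nat)}"
  \<comment> \<open>In the row of \<open>y\<close> the fourth entry is a placeholder that the flattening overwrites.\<close>
  let ?c = "case_sum (\<lambda>y. [Inl [y ! 0], Inl [y ! 1], Inl [y ! 2], Inl y]) (\<lambda>_::nat. replicate 4 (Inr (1::nat)))"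
  have card_Y: "card ?Y = 4 * (a + 2) + 1"
    by (subst card_Un_disjoint) (auto simp: card_image card_V4_basis)
  have "card ?K = 4 * (a + 2) + 1"
    by (subst card_insert_disjoint) (auto simp: card_image card_triples)
  have "border_rank ?Is ?T = card ?Y"
  proof (rule border_rank_eqI[where p = 3 and c = ?c and K = ?K and v = "approx_factors a"])
    show "?c y \<in> listset ?Is" if "y \<in> ?Y" for y
      using that \<open>a \<ge> 1\<close> by (auto simp: triples_def sum_spaces_eq mem_listset_iff
          numeral_eq_Suc elim!: V4_basisE simp del: listset.simps)
    show "?T ((?c y)[3 := z]) = (if y = z then 1 else 0)" if "y \<in> ?Y" "z \<in> ?Y" for y z
      using that \<open>a \<ge> 1\<close>
      by (auto simp: V4_basis_def T1_at_node T2_at direct_sum_def numeral_eq_Suc)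
    show "card ?K = card ?Y" using \<open>card ?K = _\<close> card_Y by simp
    fix xs assume "xs \<in> listset ?Is"
    then have "length xs = 4"
      by (auto simp: mem_listset_iff list_all2_conv_all_nth sum_spaces_eq simp del: listset.simps)
    then obtain z1 z2 z3 z4 where xs: "xs = [z1, z2, z3, z4]"
      by (auto simp: numeral_eq_Suc length_Suc_conv)
    let ?S = "\<lambda>\<epsilon>. (\<Sum>(i, j, k)\<in>triples a.
        (basis_vec (Inl [i]) z1 + \<epsilon> * sgn_of i * left_vec a k z1) *
        (basis_vec (Inl [j]) z2 + \<epsilon> * sgn_of j * right_vec a k z2) *
        (basis_vec (Inl [k]) z3 + \<epsilon> * sgn_of i * sgn_of j * weight a k / 4 * basis_vec (Inr 1) z3) *
        basis_vec (Inl [i, j, k]) z4) +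
      (\<Sum>l=1..a. basis_vec (Inr l) z1 * basis_vec (Inr l) z2) * basis_vec (Inr 1) z3 * basis_vec (Inr 1) z4"
    have "isCont ?S 0"
      unfolding case_prod_beta' by (intro continuous_intros) auto
    then have "(?S \<longlongrightarrow> ?S 0) (at 0)" by (simp add: isCont_def)
    also have "?S 0 = ?T xs"
      unfolding xs direct_sum_T1_T2 by simp
    finally have "(?S \<longlongrightarrow> ?T xs) (at 0)" .
    moreover have "\<forall>\<^sub>F \<epsilon> in at 0. ?S \<epsilon> = (\<Sum>t\<in>?K. simple_tensor (approx_factors a \<epsilon> t) xs)"
      unfolding xs eventually_at_filter
      by (intro always_eventually allI impI sum_approx_factors[symmetric])
    ultimately show "((\<lambda>\<epsilon>. \<Sum>t\<in>?K. simple_tensor (approx_factors a \<epsilon> t) xs) \<longlongrightarrow> ?T xs) (at 0)"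
      by (rule Lim_transform_eventually)
  qed (use approx_factors_mem in \<open>auto simp: sum_spaces_eq\<close>)
  then show ?thesis using card_Y by simp
qed

theorem theorem3p2:
  fixes a :: nat
  assumes "a \<ge> 2"
  shows "border_rank (V_spaces a) (T1 a) = 4 * (a + 2) \<and>
         border_rank (W_spaces a) (T2 a) = a \<and>
         border_rank (sum_spaces (V_spaces a) (W_spaces a)) (direct_sum (T1 a) (T2 a))
           = 4 * (a + 2) + 1"
  using border_rank_T1 border_rank_T2 border_rank_direct_sum assms by simp

end
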